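(* Let $p,q>0$ and let $X_1,X_2,\ldots$ be independent identically distributed real random variables. Assume that $\mathbf E X_1=0$ and $$\mathbf E\Big(|X_1|^\mu\,(\log|X_1|)^{-\mu/2}\Big)<+\infty\quad\text{for some }\mu>2,$$ where $\log x$ is understood as $\log\max\{x,e\}$. Then there exists some $C_1>0$ such that $$\mathbf P\Big(\limsup_{N\to+\infty}\Big|\frac1{\sqrt{N\log N}}\sum_{n=1}^N\sqrt{w_{p,q}(n/N)}\,X_n\Big|\le C_1\sqrt{\mathbf E X_1^2}\Big)=1.$$
   Context: For $p,q>0$, $$w_{p,q}(x)=\Big(\int_0^1\exp(-s^{-p}(1-s)^{-q})\,ds\Big)^{-1}\exp\big(-x^{-p}(1-x)^{-q}\big)\ (x\in(0,1)),\qquad w_{p,q}(x)=0\ (x\notin(0,1)).$$ *)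

theory Defs
  imports "HOL-Probability.Probability"
begin

definition bump :: "real \<Rightarrow> real \<Rightarrow> real \<Rightarrow> real" where
  "bump p q s = exp (- (s powr (- p) * (1 - s) powr (- q)))"

definition weight :: "real \<Rightarrow> real \<Rightarrow> real \<Rightarrow> real" where
  "weight p q x =
     (if x \<in> {0<..<1}
      then inverse (LBINT s:{0<..<1}. bump p q s) * bump p q x
      else 0)"

text \<open>Natural logarithm, with the convention that \<open>log x\<close> stands for \<open>log max{x, e}\<close>.\<close>

definition Log :: "real \<Rightarrow> real" where
  "Log x = ln (max x (exp 1))"

end

theory Submission
  imports Defs "HOL-Real_Asymp.Real_Asymp"
begin

text \<open>
  The weights \<open>sqrt (weight p q (n / N))\<close> are bounded by a constant \<open>A\<close> that depends only on \<open>p\<close>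
  and \<open>q\<close>, and boundedness is the property of the weights that carries the proof.
  The moment hypothesis, with exponent \<open>\<mu>\<close>, yields a finite absolute moment of some order \<open>\<nu> > 2\<close> (lemma \<open>powr_le_powr_Log\<close>), and the theorem follows from
  the almost sure bound \<open>\<bar>\<Sum>n\<le>N. a N n * X n\<bar> = O(sqrt (N * Log N))\<close> for bounded triangular arrays
  \<open>a\<close> (lemma \<open>weighted_sum_growth\<close>).

  The rows of such an array may be unrelated, so that a bound for one \<open>N\<close> says nothing about its
  neighbours.  The method is therefore to make the exceptional probabilities summable
  over all \<open>N\<close>.  The variable \<open>X n\<close> is replaced by \<open>0\<close> where its modulus exceeds \<open>n powr \<alpha>\<close>, with
  \<open>1 / \<nu> < \<alpha> < 1 / 2\<close>.  By \<open>\<alpha> > 1 / \<nu>\<close>, Markov's inequality and Borel--Cantelli, almost surely only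
  finitely many variables are changed; since the same variables serve every row, this alters all
  weighted sums by at most one random constant.  By \<open>\<alpha> < 1 / 2\<close>, the exponential moments of the
  truncated sum at \<open>t = sqrt (Log N / N)\<close> are controlled by means and variances, as \<open>t * n powr \<alpha>\<close> is
  small for all \<open>n \<le> N\<close>; Chernoff's method (lemma \<open>weighted_truncated_sum_tail\<close>) then bounds the
  probability that the sum exceeds \<open>C * sqrt (N * Log N)\<close> by \<open>1 / N\<^sup>2\<close>, once \<open>C\<close> is large.
  The means that truncation introduces add up to \<open>O(sqrt N)\<close>.

  The constant \<open>C\<close> depends on the distribution of \<open>X 1\<close>; dividing it by the standard deviation
  gives \<open>C\<^sub>1\<close>.  If the standard deviation is \<open>0\<close>, all sums vanish almost surely.
\<close>

section \<open>Elementary inequalities\<close>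

definition truncate :: "real \<Rightarrow> real \<Rightarrow> real" where
  "truncate b x = (if \<bar>x\<bar> \<le> b then x else 0)"

lemma truncate_measurable [measurable]: "truncate b \<in> borel_measurable borel"
  unfolding truncate_def [abs_def] by measurable

lemma abs_truncate_le: "\<bar>truncate b x\<bar> \<le> \<bar>x\<bar>"
  by (simp add: truncate_def)

lemma abs_truncate_le_level: "0 \<le> b \<Longrightarrow> \<bar>truncate b x\<bar> \<le> b"
  by (simp add: truncate_def)

text \<open>
  On the negative axis, the bound follows from \<open>exp (- y) \<le> 1 / (1 + y)\<close> and
  \<open>(1 + y) * (1 - y + y\<^sup>2) = 1 + y ^ 3\<close>.  Having no absolute value in the linear term
  keeps the mean of a variable, rather than its absolute mean, in the bounds on exponential moments.
\<close>

lemma exp_le_quadratic: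
  fixes x :: real
  assumes "x \<le> 1"
  shows "exp x \<le> 1 + x + x\<^sup>2"
proof (cases "x \<ge> 0")
  case True
  then show ?thesis using assms by (rule exp_bound)
next
  case False
  define y where "y = - x"
  have y: "y > 0" using False by (simp add: y_def)
  have "1 \<le> (1 + y) * (1 - y + y\<^sup>2)"
    using y by (simp add: algebra_simps power2_eq_square)
  also have "\<dots> \<le> exp y * (1 - y + y\<^sup>2)"
  proof (rule mult_right_mono)
    show "0 \<le> 1 - y + y\<^sup>2"
      using zero_le_power2[of "y - 1"] y by (simp add: power2_eq_square algebra_simps)
  qed (use y in simp)
  finally have "exp (- y) \<le> 1 - y + y\<^sup>2"
    by (simp add: exp_minus field_simps)
  then show ?thesis by (simp add: y_def)
qed

lemma sum_inverse_sqrt_le: "(\<Sum>n=1..N. real n powr (- 1 / 2)) \<le> 2 * sqrt (real N)"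
proof (induction N)
  case 0
  then show ?case by simp
next
  case (Suc N)
  define u v where "u = sqrt (real N)" and "v = sqrt (real (Suc N))"
  have v: "v > 0" and u: "u \<ge> 0" by (simp_all add: u_def v_def)
  have "v\<^sup>2 - u\<^sup>2 = 1" by (simp add: u_def v_def)
  moreover have "2 * (u * v) \<le> u\<^sup>2 + v\<^sup>2"
    using zero_le_power2[of "u - v"] by (simp add: power2_eq_square algebra_simps)
  ultimately have "2 * u + 1 / v \<le> 2 * v"
    using v by (simp add: field_simps power2_eq_square)
  moreover have "real (Suc N) powr (- 1 / 2) = 1 / v"
    using powr_minus_divide[of "real (Suc N)" "1/2"] by (simp add: v_def powr_half_sqrt)
  ultimately show ?case using Suc by (simp add: u_def v_def)
qed

lemma Log_ge_1: "Log x \<ge> 1"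
proof -
  have "ln (exp 1) \<le> ln (max x (exp 1))" by (subst ln_le_cancel_iff) (auto simp: less_max_iff_disj)
  then show ?thesis by (simp add: Log_def)
qed

lemma exp_minus_Log_le:
  assumes "N > 0"
  shows "exp (- 2 * Log (real N)) \<le> 1 / (real N)\<^sup>2"
proof -
  have "ln (real N) \<le> Log (real N)"
    unfolding Log_def using assms by (subst ln_le_cancel_iff) (auto simp: less_max_iff_disj)
  then have "exp (- 2 * Log (real N)) \<le> exp (- 2 * ln (real N))" by simp
  also have "\<dots> = 1 / (real N)\<^sup>2"
    using assms by (simp add: exp_minus exp_double field_simps)
  finally show ?thesis .
qed

text \<open>
  The logarithmic factor costs less than any power, so a moment of every order below \<open>\<mu>\<close> is finite.
\<close>

lemma powr_le_powr_Log:
  fixes \<nu> \<mu> :: real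
  assumes "0 < \<nu>" "\<nu> < \<mu>"
  obtains K where "\<And>x. \<bar>x\<bar> powr \<nu> \<le> K + \<bar>x\<bar> powr \<mu> * Log \<bar>x\<bar> powr (- \<mu> / 2)"
proof -
  have "eventually (\<lambda>x::real. x powr \<nu> \<le> x powr \<mu> * ln x powr (- \<mu> / 2)) at_top"
    using assms by real_asymp
  moreover have "eventually (\<lambda>x::real. x \<ge> exp 1) at_top" by (rule eventually_ge_at_top)
  ultimately have "eventually (\<lambda>x::real. x powr \<nu> \<le> x powr \<mu> * Log x powr (- \<mu> / 2)) at_top"
    by eventually_elim (simp add: Log_def max_def)
  then obtain R where R: "\<And>x. x \<ge> R \<Longrightarrow> x powr \<nu> \<le> x powr \<mu> * Log x powr (- \<mu> / 2)"
    by (auto simp: eventually_at_top_linorder)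
  show ?thesis
  proof (rule that)
    fix x :: real
    show "\<bar>x\<bar> powr \<nu> \<le> \<bar>R\<bar> powr \<nu> + \<bar>x\<bar> powr \<mu> * Log \<bar>x\<bar> powr (- \<mu> / 2)"
    proof (cases "\<bar>x\<bar> \<ge> R")
      case True
      then show ?thesis using R[of "\<bar>x\<bar>"] by (smt (verit) powr_ge_zero)
    next
      case False
      then have "\<bar>x\<bar> powr \<nu> \<le> \<bar>R\<bar> powr \<nu>" using assms by (intro powr_mono2) auto
      then show ?thesis by (smt (verit) powr_ge_zero mult_nonneg_nonneg)
    qed
  qed
qed

section \<open>Truncated random variables\<close>

context prob_space
begin

lemma integrable_power2_if_powr:
  assumes [measurable]: "random_variable borel X"
    and "integrable M (\<lambda>\<omega>. \<bar>X \<omega>\<bar> powr \<nu>)" "\<nu> \<ge> 2"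
  shows "integrable M (\<lambda>\<omega>. (X \<omega>)\<^sup>2 :: real)"
    and "expectation (\<lambda>\<omega>. (X \<omega>)\<^sup>2) \<le> 1 + expectation (\<lambda>\<omega>. \<bar>X \<omega>\<bar> powr \<nu>)"
proof -
  have le: "x\<^sup>2 \<le> 1 + \<bar>x\<bar> powr \<nu>" for x :: real
  proof (cases "\<bar>x\<bar> \<le> 1")
    case True
    then have "x\<^sup>2 \<le> 1" by (simp add: abs_square_le_1)
    then show ?thesis by (smt (verit) powr_ge_zero)
  next
    case False
    then have "\<bar>x\<bar> powr 2 \<le> \<bar>x\<bar> powr \<nu>" using assms by (intro powr_mono) auto
    then show ?thesis using False by (simp add: powr_numeral)
  qed
  show int: "integrable M (\<lambda>\<omega>. (X \<omega>)\<^sup>2)"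
    by (rule Bochner_Integration.integrable_bound[where f = "\<lambda>\<omega>. 1 + \<bar>X \<omega>\<bar> powr \<nu>"])
       (use assms le in \<open>auto intro!: order.trans[OF le]\<close>)
  have "expectation (\<lambda>\<omega>. (X \<omega>)\<^sup>2) \<le> expectation (\<lambda>\<omega>. 1 + \<bar>X \<omega>\<bar> powr \<nu>)"
    using int assms le by (intro integral_mono) auto
  then show "expectation (\<lambda>\<omega>. (X \<omega>)\<^sup>2) \<le> 1 + expectation (\<lambda>\<omega>. \<bar>X \<omega>\<bar> powr \<nu>)"
    using assms by (simp add: prob_space)
qed

text \<open>
  For a centred variable, the mean of the truncation is minus the mean of the part that is cut off,
  and there \<open>\<bar>x\<bar> \<le> b powr (1 - \<nu>) * \<bar>x\<bar> powr \<nu>\<close>.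
\<close>

lemma abs_expectation_truncate_le:
  assumes [measurable]: "random_variable borel X"
    and int: "integrable M X" and mean: "expectation X = 0"
    and mom: "integrable M (\<lambda>\<omega>. \<bar>X \<omega>\<bar> powr \<nu>)"
    and "\<nu> \<ge> 1" "b > 0"
  shows "\<bar>expectation (\<lambda>\<omega>. truncate b (X \<omega>))\<bar> \<le>
           b powr (1 - \<nu>) * expectation (\<lambda>\<omega>. \<bar>X \<omega>\<bar> powr \<nu>)"
proof -
  have le: "\<bar>x - truncate b x\<bar> \<le> b powr (1 - \<nu>) * \<bar>x\<bar> powr \<nu>" for x
  proof (cases "\<bar>x\<bar> \<le> b")
    case False
    have "\<bar>x\<bar> = \<bar>x\<bar> powr (1 - \<nu>) * \<bar>x\<bar> powr \<nu>"
      using False assms by (simp flip: powr_add)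
    also have "\<dots> \<le> b powr (1 - \<nu>) * \<bar>x\<bar> powr \<nu>"
      using False assms by (intro mult_right_mono powr_mono2') auto
    finally show ?thesis using False by (simp add: truncate_def)
  qed (simp add: truncate_def)
  have itr: "integrable M (\<lambda>\<omega>. truncate b (X \<omega>))"
    by (rule Bochner_Integration.integrable_bound[OF int]) (auto simp: abs_truncate_le)
  have "\<bar>expectation (\<lambda>\<omega>. truncate b (X \<omega>))\<bar> = \<bar>expectation (\<lambda>\<omega>. X \<omega> - truncate b (X \<omega>))\<bar>"
    using int itr mean by simp
  also have "\<dots> \<le> expectation (\<lambda>\<omega>. \<bar>X \<omega> - truncate b (X \<omega>)\<bar>)"
    by (rule integral_abs_bound)
  also have "\<dots> \<le> expectation (\<lambda>\<omega>. b powr (1 - \<nu>) * \<bar>X \<omega>\<bar> powr \<nu>)"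
    using int itr mom le by (intro integral_mono) auto
  finally show ?thesis by simp
qed

text \<open>
  The truncation level enters only through the requirement that the exponent be at most \<open>1\<close>
  and through the mean; the quadratic term is the full second moment, free of \<open>b\<close>.
  A bound of Hoeffding type, with \<open>b\<^sup>2\<close> in place
  of the second moment, would be too weak for levels \<open>b\<close> that grow like a power of \<open>N\<close>.
\<close>

lemma
  assumes [measurable]: "random_variable borel X"
    and sq: "integrable M (\<lambda>\<omega>. (X \<omega>)\<^sup>2)" and b: "b \<ge> 0" "\<bar>t\<bar> * b \<le> 1"
  shows integrable_exp_truncate: "integrable M (\<lambda>\<omega>. exp (t * truncate b (X \<omega>)))"
    and expectation_exp_truncate_le: "expectation (\<lambda>\<omega>. exp (t * truncate b (X \<omega>))) \<le>
          exp (t * expectation (\<lambda>\<omega>. truncate b (X \<omega>)) + t\<^sup>2 * expectation (\<lambda>\<omega>. (X \<omega>)\<^sup>2))"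
proof -
  have le1: "t * truncate b x \<le> 1" for x
  proof -
    have "t * truncate b x \<le> \<bar>t\<bar> * \<bar>truncate b x\<bar>" by (metis abs_ge_self abs_mult)
    also have "\<dots> \<le> \<bar>t\<bar> * b" using b by (intro mult_left_mono abs_truncate_le_level) auto
    finally show ?thesis using b by simp
  qed
  have itr: "integrable M (\<lambda>\<omega>. truncate b (X \<omega>))"
    by (rule integrable_const_bound[where B = b]) (auto simp: abs_truncate_le_level b)
  show iexp: "integrable M (\<lambda>\<omega>. exp (t * truncate b (X \<omega>)))"
    by (rule integrable_const_bound[where B = "exp 1"]) (auto simp: le1)
  have le: "exp (t * truncate b x) \<le> 1 + t * truncate b x + t\<^sup>2 * x\<^sup>2" for x
  proof -
    have "(t * truncate b x)\<^sup>2 \<le> t\<^sup>2 * x\<^sup>2"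
      by (auto simp: truncate_def power_mult_distrib)
    then show ?thesis using exp_le_quadratic[OF le1, of x] by simp
  qed
  have "expectation (\<lambda>\<omega>. exp (t * truncate b (X \<omega>))) \<le>
          expectation (\<lambda>\<omega>. 1 + t * truncate b (X \<omega>) + t\<^sup>2 * (X \<omega>)\<^sup>2)"
    using iexp itr sq le by (intro integral_mono) auto
  also have "\<dots> = 1 + (t * expectation (\<lambda>\<omega>. truncate b (X \<omega>)) + t\<^sup>2 * expectation (\<lambda>\<omega>. (X \<omega>)\<^sup>2))"
    using itr sq by (simp add: prob_space)
  also have "\<dots> \<le> exp (t * expectation (\<lambda>\<omega>. truncate b (X \<omega>)) + t\<^sup>2 * expectation (\<lambda>\<omega>. (X \<omega>)\<^sup>2))"
    by (rule exp_ge_add_one_self)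
  finally show "expectation (\<lambda>\<omega>. exp (t * truncate b (X \<omega>))) \<le> \<dots>" .
qed

text \<open>
  Chernoff's method: Markov's inequality for \<open>exp (t * sum)\<close>, whose expectation factorises by
  independence.  The truncated variables are not recentred; their means appear as the
  drift \<open>\<Sum>i\<in>I. m i\<close>.
\<close>

lemma weighted_truncated_sum_tail:
  assumes indep: "indep_vars (\<lambda>_. borel) X I" and fin: "finite I"
    and sq: "\<And>i. i \<in> I \<Longrightarrow> integrable M (\<lambda>\<omega>. (X i \<omega>)\<^sup>2)"
    and V: "\<And>i. i \<in> I \<Longrightarrow> expectation (\<lambda>\<omega>. (X i \<omega>)\<^sup>2) \<le> V"
    and c: "\<And>i. i \<in> I \<Longrightarrow> \<bar>c i\<bar> \<le> A"
    and b: "\<And>i. i \<in> I \<Longrightarrow> b i \<ge> 0" "\<And>i. i \<in> I \<Longrightarrow> t * A * b i \<le> 1"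
    and m: "\<And>i. i \<in> I \<Longrightarrow> \<bar>expectation (\<lambda>\<omega>. truncate (b i) (X i \<omega>))\<bar> \<le> m i"
    and t: "t > 0"
  shows "prob {\<omega> \<in> space M. (\<Sum>i\<in>I. c i * truncate (b i) (X i \<omega>)) \<ge> s} \<le>
           exp (t * A * (\<Sum>i\<in>I. m i) + real (card I) * (t\<^sup>2 * A\<^sup>2 * V) - t * s)"
proof -
  let ?Y = "\<lambda>i \<omega>. exp ((t * c i) * truncate (b i) (X i \<omega>))"
  have rv [measurable]: "random_variable borel (X i)" if "i \<in> I" for i
    using indep that by (auto simp: indep_vars_def)
  have tb: "\<bar>t * c i\<bar> * b i \<le> 1" if "i \<in> I" for i
  proof -
    have "\<bar>t * c i\<bar> * b i \<le> t * A * b i"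
      using t c[OF that] b[OF that] by (intro mult_right_mono) (auto simp: abs_mult)
    then show ?thesis using b(2)[OF that] by simp
  qed
  have iY: "integrable M (?Y i)" if "i \<in> I" for i
    using that by (intro integrable_exp_truncate rv sq b tb)
  have indepY: "indep_vars (\<lambda>_. borel) ?Y I"
    by (rule indep_vars_compose2[OF indep]) measurable
  have prodY: "(\<Prod>i\<in>I. ?Y i \<omega>) = exp (t * (\<Sum>i\<in>I. c i * truncate (b i) (X i \<omega>)))" for \<omega>
    using fin by (simp add: exp_sum sum_distrib_left mult.assoc)
  have EY: "expectation (?Y i) \<le> exp (t * A * m i + t\<^sup>2 * A\<^sup>2 * V)" if i: "i \<in> I" for i
  proof -
    have "expectation (?Y i) \<le> exp ((t * c i) * expectation (\<lambda>\<omega>. truncate (b i) (X i \<omega>)) +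
            (t * c i)\<^sup>2 * expectation (\<lambda>\<omega>. (X i \<omega>)\<^sup>2))"
      using i by (intro expectation_exp_truncate_le rv sq b tb)
    also have "\<dots> \<le> exp (t * A * m i + t\<^sup>2 * A\<^sup>2 * V)"
    proof -
      have "(t * c i) * expectation (\<lambda>\<omega>. truncate (b i) (X i \<omega>)) \<le>
              \<bar>t * c i\<bar> * \<bar>expectation (\<lambda>\<omega>. truncate (b i) (X i \<omega>))\<bar>"
        by (metis abs_ge_self abs_mult)
      also have "\<dots> \<le> t * A * m i"
        using t c[OF i] m[OF i] by (intro mult_mono) (auto simp: abs_mult)
      finally have 1: "(t * c i) * expectation (\<lambda>\<omega>. truncate (b i) (X i \<omega>)) \<le> t * A * m i" .
      have "(c i)\<^sup>2 \<le> A\<^sup>2" using c[OF i] by (simp add: abs_le_square_iff[symmetric])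
      then have "(t * c i)\<^sup>2 * expectation (\<lambda>\<omega>. (X i \<omega>)\<^sup>2) \<le> t\<^sup>2 * A\<^sup>2 * V"
        using V[OF i] by (intro mult_mono) (auto simp: power_mult_distrib intro!: mult_left_mono)
      with 1 show ?thesis by simp
    qed
    finally show ?thesis .
  qed
  have "prob {\<omega> \<in> space M. (\<Sum>i\<in>I. c i * truncate (b i) (X i \<omega>)) \<ge> s} =
          prob {\<omega> \<in> space M. exp (t * s) \<le> (\<Prod>i\<in>I. ?Y i \<omega>)}"
    using t unfolding prodY by simp
  also have "\<dots> \<le> expectation (\<lambda>\<omega>. \<Prod>i\<in>I. ?Y i \<omega>) / exp (t * s)"
    by (rule integral_Markov_inequality_measure[where A = "{}"])
       (auto intro!: indep_vars_integrable fin indepY iY prod_nonneg)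
  also have "expectation (\<lambda>\<omega>. \<Prod>i\<in>I. ?Y i \<omega>) = (\<Prod>i\<in>I. expectation (?Y i))"
    by (intro indep_vars_lebesgue_integral fin indepY iY)
  also have "\<dots> \<le> (\<Prod>i\<in>I. exp (t * A * m i + t\<^sup>2 * A\<^sup>2 * V))"
    using EY by (intro prod_mono) auto
  also have "\<dots> = exp (t * A * (\<Sum>i\<in>I. m i) + real (card I) * (t\<^sup>2 * A\<^sup>2 * V))"
    using fin by (simp add: exp_sum[symmetric] sum.distrib sum_distrib_left)
  finally show ?thesis by (simp add: exp_diff divide_right_mono)
qed

section \<open>Almost sure growth of weighted sums\<close>

text \<open>
  The variables may have different distributions as long as their moments of order \<open>\<nu>\<close> have a
  common bound \<open>K\<close>: it controls the chance that \<open>X n\<close> is changed by truncation, the mean of the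
  truncated variable, and the variance.
\<close>

lemma weighted_sum_growth:
  assumes indep: "indep_vars (\<lambda>_. borel) X {1..}"
    and int: "\<And>n. n \<ge> 1 \<Longrightarrow> integrable M (X n)"
    and mean: "\<And>n. n \<ge> 1 \<Longrightarrow> expectation (X n) = 0"
    and mom: "\<And>n. n \<ge> 1 \<Longrightarrow> integrable M (\<lambda>\<omega>. \<bar>X n \<omega>\<bar> powr \<nu>)"
    and K: "\<And>n. n \<ge> 1 \<Longrightarrow> expectation (\<lambda>\<omega>. \<bar>X n \<omega>\<bar> powr \<nu>) \<le> K"
    and nu: "\<nu> > 2"
    and a: "\<And>N n. \<bar>a N n\<bar> \<le> A"
  obtains C where "C > 0"
    "AE \<omega> in M. \<forall>\<^sub>F N in sequentially.
       \<bar>\<Sum>n=1..N. a N n * X n \<omega>\<bar> \<le> C * sqrt (real N * Log (real N))"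
proof -
  have rv: "random_variable borel (X n)" if "n \<ge> 1" for n
    using indep that by (auto simp: indep_vars_def)
  have A: "A \<ge> 0" using a[of 0 0] by simp
  have K0: "K \<ge> 0"
    by (rule order.trans[OF integral_nonneg_AE K[of 1]]) auto
  have nu2: "4 + \<nu> * 2 \<le> \<nu> * (\<nu> * 2)"
    using mult_left_mono[of 2 \<nu> \<nu>] nu by linarith
  \<comment> \<open>The midpoint of \<open>1 / \<nu>\<close> and \<open>1 / 2\<close>.  The four properties below serve, in order, monotonicity of the
    truncation levels, boundedness of the exponents, summability of the probabilities that a
    variable is changed, and the estimate \<open>O(n powr (- 1 / 2))\<close> for the truncated means.\<close>
  define al where "al = 1 / 4 + 1 / (2 * \<nu>)"
  define b where "b n = real n powr al" for n
  have al: "al > 0" "al < 1 / 2" "al * \<nu> > 1" "al * (1 - \<nu>) \<le> - 1 / 2"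
    using nu nu2 by (auto simp: al_def field_simps)
  define S where "S N \<omega> = (\<Sum>n=1..N. a N n * X n \<omega>)" for N \<omega>
  define T where "T N \<omega> = (\<Sum>n=1..N. a N n * truncate (b n) (X n \<omega>))" for N \<omega>
  \<comment> \<open>The first two terms absorb the drift and the variance in the exponent of the Chernoff bound; the
    remaining \<open>2\<close> leaves \<open>exp (- 2 * Log N) \<le> 1 / N\<^sup>2\<close>.\<close>
  define C where "C = 2 * A * K + A\<^sup>2 * (1 + K) + 2"
  have C: "C > 0" using A K0 by (auto simp: C_def intro!: add_nonneg_pos)
  have rvT [measurable]: "random_variable borel (T N)" for N
    unfolding T_def using rv
    by (intro borel_measurable_sum borel_measurable_times borel_measurable_const
         measurable_compose[OF _ truncate_measurable]) auto

  have trunc: "AE \<omega> in M. \<forall>\<^sub>F n in sequentially. \<bar>X (Suc n) \<omega>\<bar> \<le> b (Suc n)"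
  proof -
    \<comment> \<open>The index is shifted because \<open>X 0\<close> need not be measurable.\<close>
    define E where "E n = {\<omega> \<in> space M. \<bar>X (Suc n) \<omega>\<bar> powr \<nu> \<ge> b (Suc n) powr \<nu>}" for n
    have [measurable]: "E n \<in> events" for n
      unfolding E_def using rv[of "Suc n"] by measurable
    have le: "prob (E n) \<le> K * real (Suc n) powr (- (al * \<nu>))" for n
    proof -
      have "prob (E n) \<le> expectation (\<lambda>\<omega>. \<bar>X (Suc n) \<omega>\<bar> powr \<nu>) / b (Suc n) powr \<nu>"
        unfolding E_def by (rule integral_Markov_inequality_measure[where A = "{}"])
          (use mom[of "Suc n"] in \<open>auto simp: b_def\<close>)
      also have "\<dots> \<le> K / b (Suc n) powr \<nu>"
        using K[of "Suc n"] by (intro divide_right_mono) auto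
      also have "\<dots> = K * real (Suc n) powr (- (al * \<nu>))"
        by (simp add: b_def powr_powr powr_minus divide_inverse)
      finally show ?thesis .
    qed
    have "summable (\<lambda>n. real (Suc n) powr (- (al * \<nu>)))"
      using al by (subst summable_Suc_iff) (simp add: summable_real_powr_iff)
    then have "summable (\<lambda>n. prob (E n))"
      by (rule summable_comparison_test'[OF summable_mult[of _ K], of _ 0])
         (simp add: le del: of_nat_Suc)
    then have "AE \<omega> in M. \<forall>\<^sub>F n in sequentially. \<omega> \<in> space M - E n"
      by (intro borel_cantelli_AE1) (auto simp: emeasure_eq_measure)
    then show ?thesis
    proof (rule AE_mp, intro AE_I2 impI)
      fix \<omega> assume "\<forall>\<^sub>F n in sequentially. \<omega> \<in> space M - E n"
      then show "\<forall>\<^sub>F n in sequentially. \<bar>X (Suc n) \<omega>\<bar> \<le> b (Suc n)"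
      proof eventually_elim
        case (elim n)
        show ?case
        proof (rule ccontr)
          assume "\<not> ?thesis"
          then have "b (Suc n) powr \<nu> \<le> \<bar>X (Suc n) \<omega>\<bar> powr \<nu>"
            using nu by (intro powr_mono2) (auto simp: b_def)
          then show False using elim by (auto simp: E_def)
        qed
      qed
    qed
  qed

  have small: "\<forall>\<^sub>F N in sequentially. sqrt (Log (real N) / real N) * A * real N powr al \<le> 1"
  proof -
    have "((\<lambda>x::real. sqrt (ln x / x) * A * x powr al) \<longlongrightarrow> 0) at_top"
      using al by real_asymp
    then have "\<forall>\<^sub>F x::real in at_top. sqrt (ln x / x) * A * x powr al < 1"
      by (rule order_tendstoD) simp
    moreover have "\<forall>\<^sub>F x::real in at_top. x \<ge> exp 1" by (rule eventually_ge_at_top)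
    ultimately have "\<forall>\<^sub>F x::real in at_top. sqrt (Log x / x) * A * x powr al \<le> 1"
      by eventually_elim (simp add: Log_def max_def)
    then show ?thesis by (rule eventually_compose_filterlim[OF _ filterlim_real_sequentially])
  qed

  \<comment> \<open>Stated for an arbitrary row of weights, so that it applies to \<open>a N\<close> and to \<open>- a N\<close>.\<close>
  have one_sided: "prob {\<omega> \<in> space M. (\<Sum>n=1..N. c n * truncate (b n) (X n \<omega>)) \<ge>
                     C * sqrt (real N * Log (real N))} \<le> 1 / (real N)\<^sup>2"
    if N: "N > 0" and sm: "sqrt (Log (real N) / real N) * A * real N powr al \<le> 1"
      and c: "\<And>n. \<bar>c n\<bar> \<le> A" for N c
  proof -
    \<comment> \<open>This \<open>t\<close> balances the terms \<open>N * t\<^sup>2\<close> and \<open>t * sqrt (N * L)\<close> of the exponent: both equal \<open>L\<close>.\<close>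
    define L t where "L = Log (real N)" and "t = sqrt (L / real N)"
    have L: "L \<ge> 1" using Log_ge_1 by (simp add: L_def)
    have t: "t > 0" using L N by (simp add: t_def)
    define m where "m n = K * real n powr (- 1 / 2)" for n
    have "prob {\<omega> \<in> space M. (\<Sum>n=1..N. c n * truncate (b n) (X n \<omega>)) \<ge> C * sqrt (real N * L)}
        \<le> exp (t * A * (\<Sum>n=1..N. m n) + real (card {1..N}) * (t\<^sup>2 * A\<^sup>2 * (1 + K))
               - t * (C * sqrt (real N * L)))"
    proof (rule weighted_truncated_sum_tail)
      show "indep_vars (\<lambda>_. borel) X {1..N}" by (rule indep_vars_subset[OF indep]) auto
      show "integrable M (\<lambda>\<omega>. (X n \<omega>)\<^sup>2)" if "n \<in> {1..N}" for n
        using that nu by (intro integrable_power2_if_powr(1)[OF rv mom]) auto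
      show "expectation (\<lambda>\<omega>. (X n \<omega>)\<^sup>2) \<le> 1 + K" if "n \<in> {1..N}" for n
        using integrable_power2_if_powr(2)[OF rv[of n] mom[of n]] K[of n] that nu by force
      show "t * A * b n \<le> 1" if "n \<in> {1..N}" for n
      proof -
        have "b n \<le> real N powr al" unfolding b_def using that al by (intro powr_mono2) auto
        then have "t * A * b n \<le> t * A * real N powr al"
          using t A by (intro mult_left_mono) auto
        then show ?thesis using sm by (simp add: t_def L_def)
      qed
      show "\<bar>expectation (\<lambda>\<omega>. truncate (b n) (X n \<omega>))\<bar> \<le> m n" if n: "n \<in> {1..N}" for n
      proof -
        have "\<bar>expectation (\<lambda>\<omega>. truncate (b n) (X n \<omega>))\<bar> \<le>
                b n powr (1 - \<nu>) * expectation (\<lambda>\<omega>. \<bar>X n \<omega>\<bar> powr \<nu>)"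
          using n nu by (intro abs_expectation_truncate_le rv int mean mom) (auto simp: b_def)
        also have "\<dots> \<le> real n powr (- 1 / 2) * K"
        proof (intro mult_mono K)
          show "b n powr (1 - \<nu>) \<le> real n powr (- 1 / 2)"
            unfolding b_def powr_powr using n al by (intro powr_mono) auto
        qed (use n in auto)
        finally show ?thesis by (simp add: m_def mult.commute)
      qed
    qed (use c t in \<open>auto simp: b_def\<close>)
    also have "\<dots> \<le> exp (- 2 * L)"
    proof -
      have "(\<Sum>n=1..N. m n) \<le> K * (2 * sqrt (real N))"
        unfolding m_def sum_distrib_left[symmetric]
        by (intro mult_left_mono sum_inverse_sqrt_le K0)
      then have "t * A * (\<Sum>n=1..N. m n) \<le> t * A * (K * (2 * sqrt (real N)))"
        using t A by (intro mult_left_mono) auto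
      also have "\<dots> = 2 * A * K * sqrt L"
        using N L by (simp add: t_def real_sqrt_divide)
      also have "\<dots> \<le> 2 * A * K * L"
        using L A K0 by (intro mult_left_mono real_le_lsqrt) (auto simp: power2_eq_square)
      finally have 1: "t * A * (\<Sum>n=1..N. m n) \<le> 2 * A * K * L" .
      have 2: "real (card {1..N}) * (t\<^sup>2 * A\<^sup>2 * (1 + K)) = A\<^sup>2 * (1 + K) * L"
        using N L by (simp add: t_def)
      have 3: "t * (C * sqrt (real N * L)) = C * L"
        using N L by (simp add: t_def real_sqrt_divide real_sqrt_mult)
      show ?thesis using 1 unfolding 2 3 by (simp add: C_def algebra_simps)
    qed
    also have "\<dots> \<le> 1 / (real N)\<^sup>2"
      unfolding L_def by (rule exp_minus_Log_le[OF N])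
    finally show ?thesis by (simp add: L_def)
  qed

  have tail: "AE \<omega> in M. \<forall>\<^sub>F N in sequentially. \<bar>T N \<omega>\<bar> < C * sqrt (real N * Log (real N))"
  proof -
    define E where "E N = {\<omega> \<in> space M. \<bar>T N \<omega>\<bar> \<ge> C * sqrt (real N * Log (real N))}" for N
    have [measurable]: "E N \<in> events" for N unfolding E_def by measurable
    have "\<forall>\<^sub>F N in sequentially. norm (prob (E N)) \<le> 2 * (1 / (real N)\<^sup>2)"
      using small eventually_gt_at_top[of 0]
    proof eventually_elim
      case (elim N)
      let ?r = "C * sqrt (real N * Log (real N))"
      have "prob (E N) \<le> prob ({\<omega> \<in> space M. T N \<omega> \<ge> ?r} \<union> {\<omega> \<in> space M. - T N \<omega> \<ge> ?r})"
        by (intro finite_measure_mono) (auto simp: E_def)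
      also have "\<dots> \<le> prob {\<omega> \<in> space M. T N \<omega> \<ge> ?r} + prob {\<omega> \<in> space M. - T N \<omega> \<ge> ?r}"
        by (intro measure_Un_le) auto
      also have "\<dots> \<le> 1 / (real N)\<^sup>2 + 1 / (real N)\<^sup>2"
      proof (rule add_mono)
        show "prob {\<omega> \<in> space M. T N \<omega> \<ge> ?r} \<le> 1 / (real N)\<^sup>2"
          using one_sided[of N "a N"] elim a by (simp add: T_def)
        show "prob {\<omega> \<in> space M. - T N \<omega> \<ge> ?r} \<le> 1 / (real N)\<^sup>2"
          using one_sided[of N "\<lambda>n. - a N n"] elim a by (simp add: T_def sum_negf)
      qed
      finally show ?case by simp
    qed
    moreover have "summable (\<lambda>N. 2 * (1 / (real N)\<^sup>2))"
      using inverse_power_summable[of 2, where 'a = real]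
      by (intro summable_mult) (simp add: inverse_eq_divide)
    ultimately have "summable (\<lambda>N. prob (E N))"
      by (rule summable_comparison_test_ev)
    then have "AE \<omega> in M. \<forall>\<^sub>F N in sequentially. \<omega> \<in> space M - E N"
      by (intro borel_cantelli_AE1) (auto simp: emeasure_eq_measure)
    then show ?thesis
      by (rule AE_mp) (auto intro!: AE_I2 elim!: eventually_mono simp: E_def)
  qed

  show ?thesis
  proof (rule that)
    \<comment> \<open>The extra \<open>1\<close> absorbs the random constant \<open>D\<close> by which truncation changes the sums.\<close>
    show "C + 1 > 0" using C by simp
    show "AE \<omega> in M. \<forall>\<^sub>F N in sequentially.
            \<bar>\<Sum>n=1..N. a N n * X n \<omega>\<bar> \<le> (C + 1) * sqrt (real N * Log (real N))"
      using trunc tail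
    proof eventually_elim
      case (elim \<omega>)
      obtain n0 where n0: "\<And>n. n \<ge> n0 \<Longrightarrow> \<bar>X (Suc n) \<omega>\<bar> \<le> b (Suc n)"
        using elim(1) by (auto simp: eventually_sequentially)
      have eq: "truncate (b n) (X n \<omega>) = X n \<omega>" if "n > n0" for n
        using n0[of "n - 1"] that by (cases n) (auto simp: truncate_def)
      define D where "D = (\<Sum>n=1..n0. A * \<bar>X n \<omega>\<bar>)"
      have D: "\<bar>S N \<omega> - T N \<omega>\<bar> \<le> D" for N
      proof -
        have "\<bar>S N \<omega> - T N \<omega>\<bar> = \<bar>\<Sum>n=1..N. a N n * (X n \<omega> - truncate (b n) (X n \<omega>))\<bar>"
          by (simp add: S_def T_def sum_subtractf right_diff_distrib)
        also have "\<dots> \<le> (\<Sum>n=1..N. A * \<bar>X n \<omega> - truncate (b n) (X n \<omega>)\<bar>)"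
          by (rule order.trans[OF sum_abs])
             (use a in \<open>auto simp: abs_mult intro!: sum_mono mult_right_mono\<close>)
        also have "\<dots> = (\<Sum>n\<in>{1..N} \<inter> {1..n0}. A * \<bar>X n \<omega> - truncate (b n) (X n \<omega>)\<bar>)"
          by (rule sum.mono_neutral_right) (auto simp: eq)
        also have "\<dots> \<le> (\<Sum>n\<in>{1..N} \<inter> {1..n0}. A * \<bar>X n \<omega>\<bar>)"
          using A by (intro sum_mono mult_left_mono) (auto simp: truncate_def)
        also have "\<dots> \<le> D"
          unfolding D_def using A by (intro sum_mono2) auto
        finally show ?thesis .
      qed
      have "\<forall>\<^sub>F N in sequentially. D \<le> sqrt (real N)"
        using filterlim_compose[OF sqrt_at_top filterlim_real_sequentially]
        by (auto simp: filterlim_at_top)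
      with elim(2) show ?case
      proof eventually_elim
        case (elim N)
        have "sqrt (real N) \<le> sqrt (real N * Log (real N))"
          using Log_ge_1[of "real N"] mult_left_mono[of 1 "Log (real N)" "real N"] by simp
        then have "\<bar>S N \<omega>\<bar> \<le> C * sqrt (real N * Log (real N)) + sqrt (real N * Log (real N))"
          using elim D[of N] by linarith
        then show ?case by (simp add: S_def distrib_right)
      qed
    qed
  qed
qed

end

section \<open>The bump weights\<close>

text \<open>
  The bump takes values in \<open>(0, 1]\<close>, so the normalising factor bounds the weight.
\<close>

lemma abs_sqrt_weight_le:
  "\<bar>sqrt (weight p q x)\<bar> \<le> sqrt \<bar>inverse (LBINT s:{0<..<1}. bump p q s)\<bar>"
proof -
  have "0 < bump p q x" "bump p q x \<le> 1" if "0 < x" "x < 1"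
    by (auto simp: bump_def)
  then have "\<bar>weight p q x\<bar> \<le> \<bar>inverse (LBINT s:{0<..<1}. bump p q s)\<bar>"
    by (auto simp: weight_def abs_mult intro!: mult_left_le)
  then show ?thesis
    by (smt (verit) real_sqrt_le_mono real_sqrt_minus)
qed

theorem theorem1p7:
  fixes p q :: real
    and M :: "'a measure"
    and X :: "nat \<Rightarrow> 'a \<Rightarrow> real"
  assumes "p > 0" and "q > 0"
    and "prob_space M"
    and "prob_space.indep_vars M (\<lambda>_. borel) X {1..}"
    and "\<And>n. n \<ge> 1 \<Longrightarrow> distr M borel (X n) = distr M borel (X 1)"
    and "integrable M (X 1)" and "prob_space.expectation M (X 1) = 0"
    and "\<exists>\<mu>>2. integrable M (\<lambda>\<omega>. \<bar>X 1 \<omega>\<bar> powr \<mu> * Log \<bar>X 1 \<omega>\<bar> powr (- \<mu> / 2))"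
  shows "\<exists>C\<^sub>1>0. prob_space.prob M
           {\<omega> \<in> space M.
              limsup (\<lambda>N. ereal \<bar>1 / sqrt (real N * Log (real N)) *
                  (\<Sum>n=1..N. sqrt (weight p q (real n / real N)) * X n \<omega>)\<bar>)
              \<le> ereal (C\<^sub>1 * sqrt (prob_space.expectation M (\<lambda>\<omega>. (X 1 \<omega>)\<^sup>2)))} = 1"
proof -
  interpret prob_space M by fact
  from assms(8) obtain \<mu> where mu: "\<mu> > 2"
    and intmu: "integrable M (\<lambda>\<omega>. \<bar>X 1 \<omega>\<bar> powr \<mu> * Log \<bar>X 1 \<omega>\<bar> powr (- \<mu> / 2))" by blast
  have rv: "random_variable borel (X n)" if "n \<ge> 1" for n
    using assms(4) that by (auto simp: indep_vars_def)
  have rv1 [measurable]: "random_variable borel (X 1)" by (rule rv) simp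
  define \<nu> where "\<nu> = (2 + \<mu>) / 2"
  have nu: "2 < \<nu>" "\<nu> < \<mu>" using mu by (auto simp: \<nu>_def)
  obtain K where K: "\<And>x. \<bar>x\<bar> powr \<nu> \<le> K + \<bar>x\<bar> powr \<mu> * Log \<bar>x\<bar> powr (- \<mu> / 2)"
    using powr_le_powr_Log[of \<nu> \<mu>] nu by auto
  have mom1: "integrable M (\<lambda>\<omega>. \<bar>X 1 \<omega>\<bar> powr \<nu>)"
    by (rule Bochner_Integration.integrable_bound[OF
          Bochner_Integration.integrable_add[OF integrable_const[of K] intmu]])
       (auto simp del: One_nat_def intro!: AE_I2 order.trans[OF K])
  have transfer: "integrable M (\<lambda>\<omega>. f (X n \<omega>)) \<longleftrightarrow> integrable M (\<lambda>\<omega>. f (X 1 \<omega>))"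
      "expectation (\<lambda>\<omega>. f (X n \<omega>)) = expectation (\<lambda>\<omega>. f (X 1 \<omega>))"
    if n: "n \<ge> 1" and f [measurable]: "f \<in> borel_measurable borel" for n and f :: "real \<Rightarrow> real"
    using integrable_distr_eq[OF rv[OF n] f] integrable_distr_eq[OF rv1 f]
      integral_distr[OF rv[OF n] f] integral_distr[OF rv1 f] assms(5)[OF n] by simp_all
  have sq: "integrable M (\<lambda>\<omega>. (X n \<omega>)\<^sup>2)" if "n \<ge> 1" for n
    using integrable_power2_if_powr(1)[OF rv1 mom1] nu transfer(1)[OF that, of "\<lambda>x. x\<^sup>2"] by simp
  define \<sigma> where "\<sigma> = sqrt (expectation (\<lambda>\<omega>. (X 1 \<omega>)\<^sup>2))"
  define S where "S N \<omega> = (\<Sum>n=1..N. sqrt (weight p q (real n / real N)) * X n \<omega>)" for N \<omega>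
  define R where "R N \<omega> = \<bar>1 / sqrt (real N * Log (real N)) * S N \<omega>\<bar>" for N \<omega>
  have [measurable]: "random_variable borel (S N)" for N
    unfolding S_def using rv by (intro borel_measurable_sum borel_measurable_times) auto
  have [measurable]: "random_variable borel (R N)" for N
    unfolding R_def by measurable
  obtain C\<^sub>1 where C1: "C\<^sub>1 > 0"
    and ev: "AE \<omega> in M. \<forall>\<^sub>F N in sequentially. R N \<omega> \<le> C\<^sub>1 * \<sigma>"
  proof (cases "\<sigma> = 0")
    case True
    have "AE \<omega> in M. X n \<omega> = 0" if n: "n \<ge> 1" for n
    proof -
      have "expectation (\<lambda>\<omega>. (X n \<omega>)\<^sup>2) = 0"
        using True transfer(2)[OF n, of "\<lambda>x. x\<^sup>2"] by (simp add: \<sigma>_def)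
      then show ?thesis
        using integral_nonneg_eq_0_iff_AE[OF sq[OF n]] by simp
    qed
    then have "AE \<omega> in M. \<forall>n. n \<ge> 1 \<longrightarrow> X n \<omega> = 0"
      by (subst AE_all_countable) auto
    then have "AE \<omega> in M. \<forall>\<^sub>F N in sequentially. R N \<omega> \<le> 1 * \<sigma>"
      by eventually_elim (simp add: R_def S_def True)
    then show ?thesis by (rule that[rotated]) simp
  next
    case False
    then have sigma: "\<sigma> > 0"
      using integral_nonneg_AE[of "\<lambda>\<omega>. (X 1 \<omega>)\<^sup>2" M] by (auto simp: \<sigma>_def less_le)
    obtain C where C: "C > 0" and
      evC: "AE \<omega> in M. \<forall>\<^sub>F N in sequentially. \<bar>S N \<omega>\<bar> \<le> C * sqrt (real N * Log (real N))"
      unfolding S_def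
    proof (rule weighted_sum_growth[where X = X and \<nu> = \<nu>
          and a = "\<lambda>N n. sqrt (weight p q (real n / real N))"])
      show "\<bar>sqrt (weight p q (real n / real N))\<bar>
              \<le> sqrt \<bar>inverse (LBINT s:{0<..<1}. bump p q s)\<bar>" for N n
        by (rule abs_sqrt_weight_le)
      show "integrable M (X n)" "expectation (X n) = 0" if "n \<ge> 1" for n
        using transfer[OF that, of "\<lambda>x. x"] assms(6,7) by simp_all
      show "integrable M (\<lambda>\<omega>. \<bar>X n \<omega>\<bar> powr \<nu>)"
        "expectation (\<lambda>\<omega>. \<bar>X n \<omega>\<bar> powr \<nu>) \<le> expectation (\<lambda>\<omega>. \<bar>X 1 \<omega>\<bar> powr \<nu>)"
        if "n \<ge> 1" for n
        using transfer[OF that, of "\<lambda>x. \<bar>x\<bar> powr \<nu>"] mom1 by simp_all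
    qed (use assms(4) nu in auto)
    have "AE \<omega> in M. \<forall>\<^sub>F N in sequentially. R N \<omega> \<le> (C / \<sigma>) * \<sigma>"
      using evC
    proof eventually_elim
      case (elim \<omega>)
      with eventually_gt_at_top[of 0] show ?case
      proof eventually_elim
        case (elim N)
        then have "sqrt (real N * Log (real N)) > 0"
          using Log_ge_1[of "real N"] by simp
        then show ?case using elim sigma by (simp add: R_def abs_mult field_simps)
      qed
    qed
    then show ?thesis by (rule that[rotated]) (use C sigma in simp)
  qed
  from ev have "AE \<omega> in M. limsup (\<lambda>N. ereal (R N \<omega>)) \<le> ereal (C\<^sub>1 * \<sigma>)"
    by eventually_elim (auto intro!: Limsup_bounded)
  then have "prob {\<omega> \<in> space M. limsup (\<lambda>N. ereal (R N \<omega>)) \<le> ereal (C\<^sub>1 * \<sigma>)} = 1"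
    by (subst prob_Collect_eq_1) auto
  with C1 show ?thesis unfolding R_def S_def \<sigma>_def by blast
qed

end
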